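(* Let $n, S$ be positive integers, let $V$ be the $\mathbb{F}_2$-vector space of $S\times n$ matrices over $\mathbb{F}_2$, and let $P\subset V$ be an $\mathbb{F}_2$-linear subspace. For $A\in V$ let $c(A)=2^{-\mu(A)}$. Then $$\sum_{A\in P^\perp} c(A)=|P^\perp|\sum_{B\in P}\hat c(B)=\frac{1}{|P|}\sum_{B\in P}\ \prod_{1\le T\le S,\ 1\le j\le n}\bigl(1+(-1)^{b_{T,j}}2^{-j}\bigr),$$ and consequently (subtracting $c(0)=1$) $$\mathrm{WF}(P)=\frac{1}{|P|}\sum_{B\in P}\left\{\prod_{1\le T\le S,\ 1\le j\le n}\bigl(1+(-1)^{b_{T,j}}2^{-j}\bigr)-1\right\},$$ where $B=(b_{T,j})$. This quantity $\mathrm{WF}(P)$ is computable in $O(nSN)$ steps of arithmetic operations in real numbers, where $N=|P|$.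
   Context: $\mathbb{F}_2=\{0,1\}$ is the two-element field. $V=(\mathbb{F}_2^n)^S$ is the set of $S\times n$ matrices $B=(b_{T,j})_{1\le T\le S,\,1\le j\le n}$ with entries in $\mathbb{F}_2$. Inner product and orthogonal subspace: for $A=(a_{T,j}),B=(b_{T,j})\in V$, $(B|A):=\sum_{T,j} b_{T,j}a_{T,j}\in\mathbb{F}_2$ (sum modulo 2), and $\langle B|A\rangle:=(-1)^{(B|A)}\in\{1,-1\}$. For a linear subspace $P\subset V$, $P^\perp:=\{A\in V : (B|A)=0 \text{ for all } B\in P\}$. Discrete Fourier transform: for $f:V\to\mathbb{R}$, $\hat f:V\to\mathbb{R}$ is $\hat f(A):=\frac{1}{|V|}\sum_{B\in V} f(B)\langle B|A\rangle$. Weight: for $A=(a_{T,j})\in V$, $\mu(A):=\sum_{1\le T\le S,\,1\le j\le n} j\,a_{T,j}$, where each $a_{T,j}\in\{0,1\}$ is regarded as an integer. Walsh figure of merit (WAFOM): for a linear subspace $P\subset V$, $\mathrm{WF}(P):=\sum_{A\in P^\perp\setminus\{0\}}2^{-\mu(A)}$. In $(-1)^{b_{T,j}}$ the exponent is $b_{T,j}\in\{0,1\}$ regarded as an integer. Complexity convention: the elements of $P$ are given as an explicit list of matrices, one step is one arithmetic operation on real numbers, and the constant in $O(nSN)$ is absolute. *)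

theory Defs
  imports
    "Jordan_Normal_Form.VS_Connect"
    "HOL-Library.Z2"
    "HOL-Library.Monad_Syntax"
begin

text \<open>
  \<open>V\<close> is \<open>carrier_mat S n\<close> over the field \<open>bit\<close>. Matrix indices start at \<open>0\<close>, so the entry
  in row \<open>T\<close> and column \<open>j\<close> of the usual 1-based notation is \<open>A $$ (T - 1, j - 1)\<close>; in
  particular the weight and the power of two belonging to column \<open>j\<close> use the exponent \<open>Suc j\<close>.
  The coercion \<open>of_bit\<close> reads a bit as the number \<open>0\<close> or \<open>1\<close>.
\<close>

abbreviation linear_subspace :: "nat \<Rightarrow> nat \<Rightarrow> bit mat set \<Rightarrow> bool" where
  "linear_subspace S n P \<equiv> VectorSpace.subspace class_ring P (module_mat TYPE(bit) S n)"

definition inner_prod :: "bit mat \<Rightarrow> bit mat \<Rightarrow> bit" where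
  "inner_prod B A = (\<Sum>T<dim_row A. \<Sum>j<dim_col A. B $$ (T, j) * A $$ (T, j))"

definition character :: "bit mat \<Rightarrow> bit mat \<Rightarrow> real" where
  "character B A = (-1) ^ of_bit (inner_prod B A)"

definition perp :: "nat \<Rightarrow> nat \<Rightarrow> bit mat set \<Rightarrow> bit mat set" where
  "perp S n P = {A \<in> carrier_mat S n. \<forall>B\<in>P. inner_prod B A = 0}"

definition dft :: "nat \<Rightarrow> nat \<Rightarrow> (bit mat \<Rightarrow> real) \<Rightarrow> bit mat \<Rightarrow> real" where
  "dft S n f A =
     1 / real (card (carrier_mat S n :: bit mat set)) *
       (\<Sum>B\<in>carrier_mat S n. f B * character B A)"

definition weight :: "bit mat \<Rightarrow> nat" where
  "weight A = (\<Sum>T<dim_row A. \<Sum>j<dim_col A. Suc j * of_bit (A $$ (T, j)))"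

definition walsh_coeff :: "bit mat \<Rightarrow> real" where
  "walsh_coeff A = 2 powi (- int (weight A))"

definition wafom :: "nat \<Rightarrow> nat \<Rightarrow> bit mat set \<Rightarrow> real" where
  "wafom S n P = (\<Sum>A\<in>perp S n P - {0\<^sub>m S n}. 2 powi (- int (weight A)))"


section \<open>Computations with real arithmetic operations\<close>

text \<open>
  A program is one fixed, finite text that has to work for all \<open>n\<close>, \<open>S\<close> and all input lists. It
  works on real registers, numbered by natural numbers. The entries of the input matrices enter
  as the real numbers \<open>0\<close> and \<open>1\<close>, and the only constants are integers. The only control
  structures are sequencing and counting loops over the rows, the columns and the matrices of the
  input list. The cost is the number of executed real arithmetic operations.

  Loop counters are free of charge, but they only select input entries and cannot be
  converted to reals, and there are no tests. So the sequence of operations that is performed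
  depends only on the numbers \<open>n\<close>, \<open>S\<close>, \<open>N\<close>, and no part of the computation can be shifted into
  uncharged bookkeeping. Programs of this kind are a fragment of those of the usual
  real-number machines; the existence of one is therefore no weaker than the existence of an
  algorithm in such a richer model.
\<close>

datatype arith_op = Plus | Minus | Times | Divide

text \<open>In \<open>Entry i T j\<close> the three arguments are loop variables, whose current values select the
  matrix in the list, its row and its column.\<close>

datatype operand =
    Const int
  | Reg nat
  | Entry nat nat nat

datatype loop_range = Matrices | Rows | Columns

text \<open>\<open>Arith r x f y\<close> stores the value of \<open>x f y\<close> in register \<open>r\<close>;
  \<open>For v b p\<close> executes \<open>p\<close> with the loop variable \<open>v\<close> running upwards from \<open>0\<close> through the
  range \<open>b\<close>.\<close>

datatype program =
    Arith nat operand arith_op operand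
  | Seq program program
  | For nat loop_range program

fun arith_val :: "arith_op \<Rightarrow> real \<Rightarrow> real \<Rightarrow> real option" where
  "arith_val Plus x y = Some (x + y)"
| "arith_val Minus x y = Some (x - y)"
| "arith_val Times x y = Some (x * y)"
| "arith_val Divide x y = (if y = 0 then None else Some (x / y))"

fun operand_val ::
  "nat \<Rightarrow> nat \<Rightarrow> bit mat list \<Rightarrow> (nat \<Rightarrow> nat) \<Rightarrow> (nat \<Rightarrow> real) \<Rightarrow> operand \<Rightarrow> real option" where
  "operand_val S n Bs env reg (Const c) = Some (of_int c)"
| "operand_val S n Bs env reg (Reg r) = Some (reg r)"
| "operand_val S n Bs env reg (Entry i T j) =
     (if env i < length Bs \<and> env T < S \<and> env j < n
      then Some (of_bit ((Bs ! env i) $$ (env T, env j))) else None)"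

fun range_size :: "nat \<Rightarrow> nat \<Rightarrow> bit mat list \<Rightarrow> loop_range \<Rightarrow> nat" where
  "range_size S n Bs Matrices = length Bs"
| "range_size S n Bs Rows = S"
| "range_size S n Bs Columns = n"

text \<open>The result consists of the final registers and the cost; it is \<open>None\<close> if the
  program divides by zero or reads outside its input.\<close>

primrec exec ::
  "nat \<Rightarrow> nat \<Rightarrow> bit mat list \<Rightarrow> program \<Rightarrow> (nat \<Rightarrow> nat) \<Rightarrow> (nat \<Rightarrow> real)
     \<Rightarrow> ((nat \<Rightarrow> real) \<times> nat) option" where
  "exec S n Bs (Arith r x f y) = (\<lambda>env reg. do {
     a \<leftarrow> operand_val S n Bs env reg x;
     b \<leftarrow> operand_val S n Bs env reg y;
     c \<leftarrow> arith_val f a b;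
     Some (reg(r := c), 1)
   })"
| "exec S n Bs (Seq p q) = (\<lambda>env reg. do {
     (reg1, t1) \<leftarrow> exec S n Bs p env reg;
     (reg2, t2) \<leftarrow> exec S n Bs q env reg1;
     Some (reg2, t1 + t2)
   })"
| "exec S n Bs (For v b p) = (\<lambda>env reg.
     fold (\<lambda>k res. do {
         (reg1, t1) \<leftarrow> res;
         (reg2, t2) \<leftarrow> exec S n Bs p (env(v := k)) reg1;
         Some (reg2, t1 + t2)
       })
       [0..<range_size S n Bs b] (Some (reg, 0)))"

text \<open>All registers and loop variables are \<open>0\<close> at the start; the output is read from register \<open>0\<close>.\<close>

definition computes_in_steps ::
  "program \<Rightarrow> nat \<Rightarrow> nat \<Rightarrow> bit mat list \<Rightarrow> real \<Rightarrow> nat \<Rightarrow> bool" where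
  "computes_in_steps p S n Bs x t \<longleftrightarrow>
     (\<exists>reg. exec S n Bs p (\<lambda>_. 0) (\<lambda>_. 0) = Some (reg, t) \<and> reg 0 = x)"

end

theory Submission
  imports Defs
begin

text \<open>
  The characters of \<open>V\<close> restricted to the group \<open>P\<close> sum to \<open>card P\<close> or \<open>0\<close> according to
  whether they are trivial on \<open>P\<close>. Summing \<open>c\<close> against this indicator of the dual group and
  exchanging the sums gives Poisson summation; the Fourier transform of \<open>c\<close> factors over the
  entries because both \<open>c\<close> and the characters do. The algorithm evaluates the product formula
  literally, with the powers of two of a row produced by repeated halving.
\<close>

section \<open>Characters and Poisson summation\<close>

lemma UNIV_bit: "UNIV = {0, 1 :: bit}"
proof -
  have "b \<in> {0, 1}" for b :: bit
    by (cases b) auto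
  then show ?thesis by blast
qed

instance bit :: finite
  by standard (simp add: UNIV_bit)

lemma sign_sum_bit:
  "(-1::real) ^ of_bit (\<Sum>i\<in>I. f i) = (\<Prod>i\<in>I. (-1) ^ of_bit (f i))"
proof (induction I rule: infinite_finite_induct)
  case (insert i I)
  have "(-1::real) ^ of_bit (a + b) = (-1) ^ of_bit a * (-1) ^ of_bit b" for a b :: bit
    by (cases a; cases b) auto
  with insert show ?case by simp
qed auto

text \<open>Matrices are traded for extensional functions on the index rectangle, where the
  distributive law for products over \<open>PiE\<close> applies.\<close>

lemma mat_set_as_image:
  "carrier_mat m n = (\<lambda>g. mat m n g) ` (PiE ({..<m} \<times> {..<n}) (\<lambda>_. UNIV))"
proof (intro equalityI subsetI)
  fix A :: "'a mat" assume A: "A \<in> carrier_mat m n"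
  have "A = mat m n (restrict (($$) A) ({..<m} \<times> {..<n}))"
    using A by (intro eq_matI) auto
  then show "A \<in> (\<lambda>g. mat m n g) ` (PiE ({..<m} \<times> {..<n}) (\<lambda>_. UNIV))"
    by (rule image_eqI[where f = "mat m n"]) auto
qed auto

lemma inj_on_mat_PiE: "inj_on (\<lambda>g. mat m n g) (PiE ({..<m} \<times> {..<n}) B)"
proof (rule inj_onI)
  fix f g
  assume fg: "f \<in> PiE ({..<m} \<times> {..<n}) B" "g \<in> PiE ({..<m} \<times> {..<n}) B"
    and eq: "mat m n f = mat m n g"
  have "f (i, j) = g (i, j)" if "i < m" "j < n" for i j
    using arg_cong[OF eq, of "\<lambda>A. A $$ (i, j)"] that by simp
  with fg show "f = g" by (intro PiE_ext) auto
qed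

lemma finite_carrier_mat: "finite (carrier_mat m n :: 'a::finite mat set)"
  by (subst mat_set_as_image) (intro finite_imageI finite_PiE; simp)

text \<open>Expanding the product of sums chooses one entry value per position, and such a choice is
  exactly a matrix.\<close>

lemma sum_carrier_mat_prod:
  fixes h :: "nat \<Rightarrow> nat \<Rightarrow> 'a::finite \<Rightarrow> 'b::comm_semiring_1"
  shows "(\<Sum>A\<in>carrier_mat m n. \<Prod>i<m. \<Prod>j<n. h i j (A $$ (i, j)))
    = (\<Prod>i<m. \<Prod>j<n. \<Sum>b\<in>UNIV. h i j b)"
proof -
  let ?I = "{..<m} \<times> {..<n}"
  have "(\<Sum>A\<in>carrier_mat m n. \<Prod>i<m. \<Prod>j<n. h i j (A $$ (i, j)))
      = (\<Sum>g\<in>PiE ?I (\<lambda>_. UNIV). \<Prod>i<m. \<Prod>j<n. h i j (g (i, j)))"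
    by (subst mat_set_as_image, subst sum.reindex[OF inj_on_mat_PiE]) simp
  also have "\<dots> = (\<Sum>g\<in>PiE ?I (\<lambda>_. UNIV). \<Prod>x\<in>?I. h (fst x) (snd x) (g x))"
    by (simp add: prod.cartesian_product case_prod_beta)
  also have "\<dots> = (\<Prod>x\<in>?I. \<Sum>b\<in>UNIV. h (fst x) (snd x) b)"
    by (rule prod_sum_PiE[symmetric]) auto
  also have "\<dots> = (\<Prod>i<m. \<Prod>j<n. \<Sum>b\<in>UNIV. h i j b)"
    by (simp add: prod.cartesian_product case_prod_beta)
  finally show ?thesis .
qed

section \<open>The pairing of matrices\<close>

lemma inner_prod_commute:
  assumes "A \<in> carrier_mat S n" "B \<in> carrier_mat S n"
  shows "inner_prod A B = inner_prod B A"
  using assms unfolding inner_prod_def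
  by (simp only: carrier_matD mult.commute[of "B $$ _"])

lemma inner_prod_add_left:
  assumes "A \<in> carrier_mat S n" "B \<in> carrier_mat S n" "B' \<in> carrier_mat S n"
  shows "inner_prod (B + B') A = inner_prod B A + inner_prod B' A"
proof -
  have "inner_prod (B + B') A
      = (\<Sum>T<S. \<Sum>j<n. B $$ (T, j) * A $$ (T, j) + B' $$ (T, j) * A $$ (T, j))"
    unfolding inner_prod_def using assms
    by (intro sum.cong) (simp_all only: carrier_matD lessThan_iff index_add_mat distrib_right)
  then show ?thesis
    using assms by (simp only: inner_prod_def sum.distrib carrier_matD)
qed

lemma character_prod:
  assumes "A \<in> carrier_mat S n"
  shows "character B A = (\<Prod>T<S. \<Prod>j<n. (-1) ^ of_bit (B $$ (T, j) * A $$ (T, j)))"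
  using assms unfolding character_def inner_prod_def sign_sum_bit by (simp only: carrier_matD)

lemma nondegenerate_inner_prod:
  assumes B: "B \<in> carrier_mat S n" and perp: "\<And>A. A \<in> carrier_mat S n \<Longrightarrow> inner_prod B A = 0"
  shows "B = 0\<^sub>m S n"
proof (rule eq_matI)
  fix T j assume "T < dim_row (0\<^sub>m S n :: bit mat)" "j < dim_col (0\<^sub>m S n :: bit mat)"
  then have T: "T < S" and j: "j < n" by auto
  \<comment> \<open>Pairing with this matrix unit reads off the entry of \<open>B\<close> at
    \<open>(T, j)\<close>.\<close>
  define A :: "bit mat" where "A = mat S n (\<lambda>(T', j'). if T' = T \<and> j' = j then 1 else 0)"
  have "inner_prod B A = (\<Sum>T'<S. \<Sum>j'<n. if T' = T \<and> j' = j then B $$ (T, j) else 0)"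
    unfolding inner_prod_def A_def by (rule sum.cong refl | simp only: dim_row_mat dim_col_mat lessThan_iff)+ auto
  also have "\<dots> = (\<Sum>T'<S. if T' = T then B $$ (T, j) else 0)"
    using j by (intro sum.cong) simp_all
  also have "\<dots> = B $$ (T, j)"
    using T by simp
  finally show "B $$ (T, j) = 0\<^sub>m S n $$ (T, j)"
    using perp[of A] T j by (simp add: A_def)
qed (use B in auto)

section \<open>Orthogonality of characters on a subspace\<close>

context
  fixes S n :: nat and P :: "bit mat set"
  assumes subspace: "linear_subspace S n P"
begin

interpretation submodule class_ring P "module_mat TYPE(bit) S n"
  using subspace by (simp add: subspace_def)

lemma subspace_carrier: "P \<subseteq> carrier_mat S n"
  using subset by (simp add: module_mat_def)

lemma subspace_zero: "0\<^sub>m S n \<in> P"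
  using zero_closed by (simp add: module_mat_def)

lemma subspace_add: "A \<in> P \<Longrightarrow> B \<in> P \<Longrightarrow> A + B \<in> P"
  using m_closed by (simp add: module_mat_def)

lemma finite_subspace: "finite P"
  using subspace_carrier finite_carrier_mat by (rule finite_subset)

lemma card_subspace_pos: "card P > 0"
  using finite_subspace subspace_zero by (auto simp: card_gt_0_iff)

text \<open>If some \<open>C\<close> in \<open>P\<close> pairs to 1 with \<open>A\<close>,
  translation by \<open>C\<close> permutes \<open>P\<close> and flips the sign of every term, so the
  sum equals its own negative.\<close>

lemma sum_character_subspace:
  assumes A: "A \<in> carrier_mat S n"
  shows "(\<Sum>B\<in>P. character B A) = (if A \<in> perp S n P then real (card P) else 0)"
proof (cases "A \<in> perp S n P")
  case True
  then show ?thesis by (simp add: perp_def character_def)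
next
  case False
  then obtain C where C: "C \<in> P" "inner_prod C A = 1"
    using A by (auto simp: perp_def)
  note carr = subsetD[OF subspace_carrier]
  \<comment> \<open>In characteristic two a translation is its own inverse, hence a bijection of
    \<open>P\<close>.\<close>
  have invol: "C + (C + B) = B" if "B \<in> P" for B
  proof -
    have "b + (b + c) = c" for b c :: bit
      by (cases b) (auto simp flip: add.assoc)
    then show ?thesis
      using carr[OF that] carr[OF C(1)] by (intro eq_matI) auto
  qed
  have "(\<Sum>B\<in>P. character B A) = (\<Sum>B\<in>P. character (C + B) A)"
    by (rule sum.reindex_bij_witness[of _ "(+) C" "(+) C"]) (auto simp: invol subspace_add C(1))
  also have "\<dots> = (\<Sum>B\<in>P. - character B A)"
  proof (rule sum.cong)
    fix B assume "B \<in> P"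
    then have "inner_prod (C + B) A = 1 + inner_prod B A"
      using inner_prod_add_left[OF A carr[OF C(1)] carr] C(2) by simp
    then show "character (C + B) A = - character B A"
      by (cases "inner_prod B A") (auto simp: character_def)
  qed simp
  finally show ?thesis using False by (simp add: sum_negf)
qed

end

lemma linear_subspace_carrier_mat: "linear_subspace S n (carrier_mat S n)"
proof -
  interpret vectorspace class_ring "module_mat TYPE(bit) S n"
    by (rule matrix_vs)
  show ?thesis
    unfolding VectorSpace.subspace_def
    using vectorspace_axioms module_axioms
    by (auto simp: LinearCombinations.submodule_def module_mat_simps)
qed

section \<open>The orthogonal subspace and Poisson summation\<close>

lemma perp_subset: "perp S n P \<subseteq> carrier_mat S n"
  by (auto simp: perp_def)

lemma zero_mem_perp: "0\<^sub>m S n \<in> perp S n P"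
proof -
  have "inner_prod B (0\<^sub>m S n) = 0" for B
    unfolding inner_prod_def by (intro sum.neutral ballI) simp
  then show ?thesis by (simp add: perp_def)
qed

lemma perp_carrier_mat: "perp S n (carrier_mat S n) = {0\<^sub>m S n}"
proof -
  have "A = 0\<^sub>m S n" if "A \<in> perp S n (carrier_mat S n)" for A
  proof (rule nondegenerate_inner_prod)
    show carr: "A \<in> carrier_mat S n"
      using that by (simp add: perp_def)
    show "inner_prod A B = 0" if "B \<in> carrier_mat S n" for B
      using \<open>A \<in> perp S n (carrier_mat S n)\<close> that
      by (subst inner_prod_commute[OF carr that]) (simp add: perp_def)
  qed
  then show ?thesis
    using zero_mem_perp by blast
qed

text \<open>The character sum over \<open>P\<close>, divided by \<open>card P\<close>, is the
  indicator function of \<open>perp S n P\<close>. Leaving \<open>f\<close> arbitrary also covers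
  the constant 1, which counts \<open>perp S n P\<close>.\<close>

lemma sum_perp:
  assumes P: "linear_subspace S n P"
  shows "(\<Sum>A\<in>perp S n P. f A)
    = 1 / real (card P) * (\<Sum>B\<in>P. \<Sum>A\<in>carrier_mat S n. f A * character B A)"
proof -
  have "(\<Sum>B\<in>P. \<Sum>A\<in>carrier_mat S n. f A * character B A)
      = (\<Sum>A\<in>carrier_mat S n. f A * (\<Sum>B\<in>P. character B A))"
    by (subst sum.swap) (simp add: sum_distrib_left)
  also have "\<dots> = (\<Sum>A\<in>carrier_mat S n. if A \<in> perp S n P then real (card P) * f A else 0)"
    by (intro sum.cong) (simp_all add: sum_character_subspace[OF P])
  also have "\<dots> = (\<Sum>A\<in>perp S n P. real (card P) * f A)"
    using perp_subset[of S n P]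
    by (simp add: sum.inter_restrict[OF finite_carrier_mat, symmetric] Int_absorb1)
  finally show ?thesis
    using card_subspace_pos[OF P] by (simp flip: sum_distrib_left)
qed

text \<open>Double counting of the characters over \<open>P\<close> and \<open>V\<close>: summing
  over \<open>P\<close> first leaves \<open>card P\<close> for each \<open>A\<close> in the
  orthogonal subspace, while summing over \<open>V\<close> first leaves only \<open>B = 0\<close>,
  by nondegeneracy.\<close>

lemma card_perp:
  assumes P: "linear_subspace S n P"
  shows "real (card P) * real (card (perp S n P)) = real (card (carrier_mat S n :: bit mat set))"
proof -
  have "real (card P) * real (card (perp S n P))
      = (\<Sum>B\<in>P. \<Sum>A\<in>carrier_mat S n. character B A)"
    using sum_perp[OF P, of "\<lambda>_. 1"] card_subspace_pos[OF P] by simp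
  also have "\<dots> = (\<Sum>B\<in>P. \<Sum>A\<in>carrier_mat S n. character A B)"
    using subspace_carrier[OF P]
    by (intro sum.cong refl) (simp add: character_def inner_prod_commute subset_iff)
  also have "\<dots> = (\<Sum>B\<in>P. if B = 0\<^sub>m S n then real (card (carrier_mat S n :: bit mat set)) else 0)"
    using subspace_carrier[OF P]
    by (intro sum.cong refl)
      (simp add: sum_character_subspace[OF linear_subspace_carrier_mat] perp_carrier_mat subset_iff)
  also have "\<dots> = real (card (carrier_mat S n :: bit mat set))"
    using finite_subspace[OF P] subspace_zero[OF P] by simp
  finally show ?thesis .
qed

text \<open>Both sides are multiples of one double sum, with the factors \<open>1 / card P\<close>
  and \<open>card (perp S n P) / card V\<close>; these agree by \<open>card_perp\<close>.\<close>

lemma poisson_summation: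
  assumes P: "linear_subspace S n P"
  shows "(\<Sum>A\<in>perp S n P. f A) = real (card (perp S n P)) * (\<Sum>B\<in>P. dft S n f B)"
proof -
  let ?V = "carrier_mat S n :: bit mat set"
  have "(\<Sum>B\<in>P. dft S n f B) = 1 / real (card ?V) * (\<Sum>B\<in>P. \<Sum>A\<in>?V. f A * character B A)"
  proof -
    have "dft S n f B = 1 / real (card ?V) * (\<Sum>A\<in>?V. f A * character B A)" if "B \<in> P" for B
      unfolding dft_def using subspace_carrier[OF P] that
      by (auto intro!: sum.cong simp: character_def inner_prod_commute)
    then show ?thesis by (simp add: sum_distrib_left)
  qed
  moreover have "real (card (perp S n P)) = real (card ?V) / real (card P)"
    using card_perp[OF P] card_subspace_pos[OF P] by (simp add: eq_divide_eq mult.commute)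
  moreover have "real (card ?V) \<noteq> 0"
    using card_subspace_pos[OF linear_subspace_carrier_mat, of S n] by simp
  ultimately show ?thesis
    by (simp add: sum_perp[OF P])
qed

section \<open>The Walsh coefficients\<close>

lemma two_powi_neg: "(2::real) powi (- int k) = (1/2) ^ k"
  by (simp add: power_int_minus power_divide inverse_eq_divide)

text \<open>The contribution of a single entry to the unnormalised Fourier transform of
  \<open>walsh_coeff\<close>. The natural power of 1/2 is the form that repeated halving
  produces.\<close>

definition walsh_factor :: "nat \<Rightarrow> bit \<Rightarrow> real" where
  "walsh_factor j b = 1 + (-1) ^ of_bit b * (1/2) ^ Suc j"

lemma walsh_coeff_prod:
  assumes "A \<in> carrier_mat S n"
  shows "walsh_coeff A = (\<Prod>T<S. \<Prod>j<n. (1/2) ^ (Suc j * of_bit (A $$ (T, j))))"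
  using assms unfolding walsh_coeff_def two_powi_neg weight_def power_sum
  by (simp only: carrier_matD)

lemma walsh_coeff_zero: "walsh_coeff (0\<^sub>m S n) = 1"
  by (simp add: walsh_coeff_def weight_def)

text \<open>Weight and pairing are both sums over entries, so the summand is a product over entries
  and the sum factors. At each position the bit 0 contributes 1 and the bit 1 contributes the signed
  power of 1/2.\<close>

lemma sum_walsh_coeff_character:
  "(\<Sum>A\<in>carrier_mat S n. walsh_coeff A * character B A)
    = (\<Prod>T<S. \<Prod>j<n. walsh_factor j (B $$ (T, j)))"
proof -
  let ?h = "\<lambda>T j b. (1/2::real) ^ (Suc j * of_bit b) * (-1) ^ of_bit (B $$ (T, j) * b)"
  have factor: "(\<Sum>b\<in>UNIV. ?h T j b) = walsh_factor j (B $$ (T, j))" for T j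
    by (cases "B $$ (T, j)") (simp_all add: UNIV_bit walsh_factor_def)
  have "(\<Sum>A\<in>carrier_mat S n. walsh_coeff A * character B A)
      = (\<Sum>A\<in>carrier_mat S n. \<Prod>T<S. \<Prod>j<n. ?h T j (A $$ (T, j)))"
    by (intro sum.cong refl) (simp only: walsh_coeff_prod character_prod prod.distrib)
  also have "\<dots> = (\<Prod>T<S. \<Prod>j<n. \<Sum>b\<in>UNIV. ?h T j b)"
    by (rule sum_carrier_mat_prod)
  also have "\<dots> = (\<Prod>T<S. \<Prod>j<n. walsh_factor j (B $$ (T, j)))"
    by (simp only: factor)
  finally show ?thesis .
qed

lemma sum_perp_walsh_coeff:
  assumes "linear_subspace S n P"
  shows "(\<Sum>A\<in>perp S n P. walsh_coeff A)
    = 1 / real (card P) * (\<Sum>B\<in>P. \<Prod>T<S. \<Prod>j<n. walsh_factor j (B $$ (T, j)))"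
  by (simp add: sum_perp[OF assms] sum_walsh_coeff_character)

lemma wafom_formula:
  assumes P: "linear_subspace S n P"
  shows "wafom S n P
    = 1 / real (card P) * (\<Sum>B\<in>P. (\<Prod>T<S. \<Prod>j<n. walsh_factor j (B $$ (T, j))) - 1)"
proof -
  have "finite (perp S n P)"
    using perp_subset finite_carrier_mat by (rule finite_subset)
  then have "wafom S n P = (\<Sum>A\<in>perp S n P. walsh_coeff A) - walsh_coeff (0\<^sub>m S n)"
    unfolding wafom_def by (simp add: sum_diff1 zero_mem_perp walsh_coeff_def)
  \<comment> \<open>The term 1 of the zero matrix is the average of 1 over \<open>P\<close>, so it
    can be subtracted inside the sum.\<close>
  then show ?thesis
    using card_subspace_pos[OF P]
    by (simp add: sum_perp_walsh_coeff[OF P] walsh_coeff_zero sum_subtractf field_simps)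
qed

section \<open>The algorithm\<close>

text \<open>\<open>I k\<close> describes the registers after \<open>k\<close> passes. A single cost
  \<open>c\<close> for every pass suffices because programs have no tests; \<open>exec\<close>
  returns no bindings, so each pass starts again from \<open>env\<close>.\<close>

lemma exec_For_invariant:
  assumes init: "I 0 reg"
    and step: "\<And>k reg. k < range_size S n Bs b \<Longrightarrow> I k reg \<Longrightarrow>
      \<exists>reg'. exec S n Bs p (env(v := k)) reg = Some (reg', c) \<and> I (Suc k) reg'"
  shows "\<exists>reg'. exec S n Bs (For v b p) env reg = Some (reg', range_size S n Bs b * c)
    \<and> I (range_size S n Bs b) reg'"
proof -
  let ?body = "\<lambda>k res. do {
         (reg1, t1) \<leftarrow> res;
         (reg2, t2) \<leftarrow> exec S n Bs p (env(v := k)) reg1;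
         Some (reg2, t1 + t2)
       }"
  \<comment> \<open>The induction runs over initial segments of the range, so that the bound stays
    fixed for \<open>step\<close>.\<close>
  have "m \<le> range_size S n Bs b \<Longrightarrow>
      \<exists>reg'. fold ?body [0..<m] (Some (reg, 0)) = Some (reg', m * c) \<and> I m reg'" for m
  proof (induction m)
    case (Suc m)
    obtain reg1 where reg1: "fold ?body [0..<m] (Some (reg, 0)) = Some (reg1, m * c)" "I m reg1"
      using Suc.IH[OF Suc_leD[OF Suc.prems]] by blast
    obtain reg2 where "exec S n Bs p (env(v := m)) reg1 = Some (reg2, c)" "I (Suc m) reg2"
      using step[of m reg1] Suc.prems reg1(2) by auto
    with reg1(1) show ?case by (simp del: fun_upd_apply)
  qed (use init in simp)
  then show ?thesis by simp
qed

text \<open>Registers: 0 is the accumulated sum and finally the result, 1 the product over the current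
  matrix, 2 the power of two, 3 the current factor, and 4 counts the matrices, since \<open>N\<close> is not
  available as an operand.\<close>

definition entry_prog :: program where
  "entry_prog =
    Seq (Arith 2 (Reg 2) Divide (Const 2))
    (Seq (Arith 3 (Entry 0 1 2) Times (Const 2))
    (Seq (Arith 3 (Const 1) Minus (Reg 3))
    (Seq (Arith 3 (Reg 3) Times (Reg 2))
    (Seq (Arith 3 (Const 1) Plus (Reg 3))
    (Arith 1 (Reg 1) Times (Reg 3))))))"

text \<open>There is no plain assignment, so the constant 1 is loaded by a charged addition of 0.
  This restarts the powers of two in each row.\<close>

definition row_prog :: program where
  "row_prog = Seq (Arith 2 (Const 1) Plus (Const 0)) (For 2 Columns entry_prog)"

definition matrix_prog :: program where
  "matrix_prog =
    Seq (Arith 1 (Const 1) Plus (Const 0))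
    (Seq (For 1 Rows row_prog)
    (Seq (Arith 1 (Reg 1) Minus (Const 1))
    (Seq (Arith 0 (Reg 0) Plus (Reg 1))
    (Arith 4 (Reg 4) Plus (Const 1)))))"

definition wafom_prog :: program where
  "wafom_prog = Seq (For 0 Matrices matrix_prog) (Arith 0 (Reg 0) Divide (Reg 4))"

text \<open>On bits, \<open>1 - 2 * b\<close> equals \<open>(-1) ^ b\<close>, so the sign needs no
  test. Halving comes first: column index \<open>j\<close> counts from 0 but uses the exponent
  \<open>Suc j\<close>.\<close>

lemma exec_entry_prog:
  assumes "env 0 < length Bs" "env 1 < S" "env 2 < n"
    and "reg 2 = (1/2) ^ env 2"
  shows "\<exists>reg'. exec S n Bs entry_prog env reg = Some (reg', 6)
    \<and> reg' 0 = reg 0 \<and> reg' 1 = reg 1 * walsh_factor (env 2) (Bs ! env 0 $$ (env 1, env 2))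
    \<and> reg' 2 = (1/2) ^ Suc (env 2) \<and> reg' 4 = reg 4"
  using assms
  by (cases "Bs ! env 0 $$ (env 1, env 2)") (simp_all add: entry_prog_def walsh_factor_def)

lemma exec_row_prog:
  assumes "env 0 < length Bs" "env 1 < S"
  shows "\<exists>reg'. exec S n Bs row_prog env reg = Some (reg', 1 + n * 6)
    \<and> reg' 0 = reg 0 \<and> reg' 1 = reg 1 * (\<Prod>j<n. walsh_factor j (Bs ! env 0 $$ (env 1, j)))
    \<and> reg' 4 = reg 4"
proof -
  \<comment> \<open>The clause on register 2 supplies the precondition of
    \<open>exec_entry_prog\<close> at column \<open>k\<close>; register 1 keeps the product of
    earlier rows as a factor.\<close>
  define I where "I k reg' \<longleftrightarrow> reg' 0 = reg 0
    \<and> reg' 1 = reg 1 * (\<Prod>j<k. walsh_factor j (Bs ! env 0 $$ (env 1, j)))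
    \<and> reg' 2 = (1/2) ^ k \<and> reg' 4 = reg 4" for k and reg' :: "nat \<Rightarrow> real"
  have "\<exists>reg'. exec S n Bs (For 2 Columns entry_prog) env (reg(2 := 1))
      = Some (reg', range_size S n Bs Columns * 6) \<and> I (range_size S n Bs Columns) reg'"
  proof (rule exec_For_invariant)
    fix k reg1 assume "k < range_size S n Bs Columns" "I k reg1"
    then show "\<exists>reg'. exec S n Bs entry_prog (env(2 := k)) reg1 = Some (reg', 6) \<and> I (Suc k) reg'"
      using exec_entry_prog[of "env(2 := k)" Bs S n reg1] assms by (auto simp: I_def mult.assoc)
  qed (simp add: I_def)
  \<comment> \<open>The loop equation of \<open>exec\<close> is withheld from simp, so that the loop
    stays folded and matches the fact just proved.\<close>
  then show ?thesis
    by (auto simp: row_prog_def I_def simp del: exec.simps(3))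
qed

text \<open>The 4 operations outside the row loop reset the product, subtract 1, accumulate the
  result and count the matrix.\<close>

lemma exec_matrix_prog:
  assumes "env 0 < length Bs"
  shows "\<exists>reg'. exec S n Bs matrix_prog env reg = Some (reg', 4 + S * (1 + n * 6))
    \<and> reg' 0 = reg 0 + ((\<Prod>T<S. \<Prod>j<n. walsh_factor j (Bs ! env 0 $$ (T, j))) - 1)
    \<and> reg' 4 = reg 4 + 1"
proof -
  define I where "I k reg' \<longleftrightarrow> reg' 0 = reg 0
    \<and> reg' 1 = (\<Prod>T<k. \<Prod>j<n. walsh_factor j (Bs ! env 0 $$ (T, j)))
    \<and> reg' 4 = reg 4" for k and reg' :: "nat \<Rightarrow> real"
  have "\<exists>reg'. exec S n Bs (For 1 Rows row_prog) env (reg(1 := 1))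
      = Some (reg', range_size S n Bs Rows * (1 + n * 6)) \<and> I (range_size S n Bs Rows) reg'"
  proof (rule exec_For_invariant)
    fix k reg1 assume "k < range_size S n Bs Rows" "I k reg1"
    then show "\<exists>reg'. exec S n Bs row_prog (env(1 := k)) reg1 = Some (reg', 1 + n * 6) \<and> I (Suc k) reg'"
      using exec_row_prog[of "env(1 := k)" Bs S n reg1] assms by (auto simp: I_def)
  qed (simp add: I_def)
  then show ?thesis
    by (auto simp: matrix_prog_def I_def simp del: exec.simps(3))
qed

text \<open>Register 4 ends as the length of the list, so a nonempty list makes the final division
  legal; that division is the extra step in the cost.\<close>

lemma exec_wafom_prog:
  assumes "Bs \<noteq> []"
  shows "\<exists>reg'. exec S n Bs wafom_prog env (\<lambda>_. 0)
      = Some (reg', length Bs * (4 + S * (1 + n * 6)) + 1)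
    \<and> reg' 0 = (\<Sum>i<length Bs. (\<Prod>T<S. \<Prod>j<n. walsh_factor j (Bs ! i $$ (T, j))) - 1)
        / real (length Bs)"
proof -
  define I where "I k reg' \<longleftrightarrow>
    reg' 0 = (\<Sum>i<k. (\<Prod>T<S. \<Prod>j<n. walsh_factor j (Bs ! i $$ (T, j))) - 1)
    \<and> reg' 4 = real k" for k and reg' :: "nat \<Rightarrow> real"
  have "\<exists>reg'. exec S n Bs (For 0 Matrices matrix_prog) env (\<lambda>_. 0)
      = Some (reg', range_size S n Bs Matrices * (4 + S * (1 + n * 6)))
      \<and> I (range_size S n Bs Matrices) reg'"
  proof (rule exec_For_invariant)
    fix k reg1 assume "k < range_size S n Bs Matrices" "I k reg1"
    then show "\<exists>reg'. exec S n Bs matrix_prog (env(0 := k)) reg1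
        = Some (reg', 4 + S * (1 + n * 6)) \<and> I (Suc k) reg'"
      using exec_matrix_prog[of "env(0 := k)" Bs S n reg1] by (auto simp: I_def)
  qed (simp add: I_def)
  then show ?thesis
    using assms by (auto simp: wafom_prog_def I_def simp del: exec.simps(3))
qed

lemma wafom_prog_correct:
  assumes P: "linear_subspace S n P" and Bs: "distinct Bs" "set Bs = P"
  shows "computes_in_steps wafom_prog S n Bs (wafom S n P)
    (card P * (4 + S * (1 + n * 6)) + 1)"
proof -
  have len: "length Bs = card P"
    using distinct_card[OF Bs(1)] Bs(2) by simp
  have "Bs \<noteq> []"
    using subspace_zero[OF P] Bs(2) by auto
  then obtain reg' where reg': "exec S n Bs wafom_prog (\<lambda>_. 0) (\<lambda>_. 0)
        = Some (reg', length Bs * (4 + S * (1 + n * 6)) + 1)"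
      "reg' 0 = (\<Sum>i<length Bs. (\<Prod>T<S. \<Prod>j<n. walsh_factor j (Bs ! i $$ (T, j))) - 1)
        / real (length Bs)"
    using exec_wafom_prog by blast
  \<comment> \<open>Distinctness makes the list an enumeration of \<open>P\<close> without
    repetition, which turns the sum over positions into the sum over \<open>P\<close>.\<close>
  have "bij_betw ((!) Bs) {..<length Bs} P"
    using Bs by (intro bij_betw_nth) auto
  then have "(\<Sum>i<length Bs. (\<Prod>T<S. \<Prod>j<n. walsh_factor j (Bs ! i $$ (T, j))) - 1)
      = (\<Sum>B\<in>P. (\<Prod>T<S. \<Prod>j<n. walsh_factor j (B $$ (T, j))) - 1)"
    by (rule sum.reindex_bij_betw)
  then have "reg' 0 = wafom S n P"
    unfolding wafom_formula[OF P] reg'(2) len by simp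
  then show ?thesis
    using reg'(1) unfolding computes_in_steps_def len by blast
qed

theorem corollary4p2:
  shows "(\<forall>(n::nat) (S::nat) (P::bit mat set).
            n \<ge> 1 \<longrightarrow> S \<ge> 1 \<longrightarrow> linear_subspace S n P \<longrightarrow>
              (\<Sum>A\<in>perp S n P. walsh_coeff A)
                = real (card (perp S n P)) * (\<Sum>B\<in>P. dft S n walsh_coeff B)
            \<and> real (card (perp S n P)) * (\<Sum>B\<in>P. dft S n walsh_coeff B)
                = 1 / real (card P) *
                  (\<Sum>B\<in>P. \<Prod>T<S. \<Prod>j<n. 1 + (-1) ^ of_bit (B $$ (T, j)) * 2 powi (- int (Suc j)))
            \<and> walsh_coeff (0\<^sub>m S n) = 1
            \<and> wafom S n P
                = 1 / real (card P) *
                  (\<Sum>B\<in>P. (\<Prod>T<S. \<Prod>j<n. 1 + (-1) ^ of_bit (B $$ (T, j)) * 2 powi (- int (Suc j))) - 1))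
       \<and> (\<exists>(p::program) (C::nat). \<forall>(n::nat) (S::nat) (P::bit mat set) (Bs::bit mat list).
            n \<ge> 1 \<longrightarrow> S \<ge> 1 \<longrightarrow> linear_subspace S n P \<longrightarrow> distinct Bs \<longrightarrow> set Bs = P \<longrightarrow>
              (\<exists>t. computes_in_steps p S n Bs (wafom S n P) t \<and> t \<le> C * (n * S * card P)))"
proof (rule conjI; (rule exI[of _ wafom_prog], rule exI[of _ 12])?; intro allI impI conjI)
  fix n S :: nat and P :: "bit mat set"
  assume P: "linear_subspace S n P"
  have factor: "walsh_factor j b = 1 + (-1) ^ of_bit b * 2 powi (- int (Suc j))" for j b
    unfolding walsh_factor_def two_powi_neg ..
  show "(\<Sum>A\<in>perp S n P. walsh_coeff A)
      = real (card (perp S n P)) * (\<Sum>B\<in>P. dft S n walsh_coeff B)"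
    by (rule poisson_summation[OF P])
  then show "real (card (perp S n P)) * (\<Sum>B\<in>P. dft S n walsh_coeff B)
      = 1 / real (card P) *
        (\<Sum>B\<in>P. \<Prod>T<S. \<Prod>j<n. 1 + (-1) ^ of_bit (B $$ (T, j)) * 2 powi (- int (Suc j)))"
    unfolding factor[symmetric] using sum_perp_walsh_coeff[OF P] by simp
  show "walsh_coeff (0\<^sub>m S n) = 1"
    by (rule walsh_coeff_zero)
  show "wafom S n P = 1 / real (card P) *
      (\<Sum>B\<in>P. (\<Prod>T<S. \<Prod>j<n. 1 + (-1) ^ of_bit (B $$ (T, j)) * 2 powi (- int (Suc j))) - 1)"
    unfolding factor[symmetric] by (rule wafom_formula[OF P])
next
  fix n S :: nat and P :: "bit mat set" and Bs :: "bit mat list"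
  assume nS: "n \<ge> 1" "S \<ge> 1" and P: "linear_subspace S n P" and Bs: "distinct Bs" "set Bs = P"
  have "1 \<le> S * n" "S \<le> S * n"
    using nS by auto
  moreover have "S * (1 + n * 6) = S + 6 * (S * n)"
    by (simp add: algebra_simps)
  \<comment> \<open>The final division is charged to every matrix, turning 4 into 5, as
    \<open>P\<close> is nonempty. Then \<open>5 + S + 6 * (S * n)\<close> is at most
    \<open>(5 + 1 + 6) * (S * n)\<close>, whence the constant 12.\<close>
  ultimately have "5 + S * (1 + n * 6) \<le> 12 * (S * n)"
    by linarith
  then have "card P * (5 + S * (1 + n * 6)) \<le> card P * (12 * (S * n))"
    by (rule mult_left_mono) simp
  then have "card P * (4 + S * (1 + n * 6)) + 1 \<le> 12 * (n * S * card P)"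
    using card_subspace_pos[OF P] by (simp add: algebra_simps)
  then show "\<exists>t. computes_in_steps wafom_prog S n Bs (wafom S n P) t \<and> t \<le> 12 * (n * S * card P)"
    using wafom_prog_correct[OF P Bs] by blast
qed

end
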